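(* Let $U\in\mathcal{U}$ satisfy $F(x)\leqslant U(x)$ for all $x\in\mathcal{X}^n$. Then $$\rho_n\leqslant\rho_n^{\mathrm{var}}\leqslant\rho_n^U.$$ In addition, if $(u_\star,\alpha_\star,\beta_\star)$ is an optimal solution of the problem $$\inf\Big\{\prod_{i=1}^n(\alpha_i+\beta_i^\top\mu_i)\ :\ u_i:\mathcal{X}\to\mathbb{R}^+,\ \alpha_i\in\mathbb{R},\ \beta_i\in\mathbb{R}^m,\ u_i(x_i)\leqslant\alpha_i+\beta_i^\top g_i(x_i)\ \forall i,\forall x_i\in\mathcal{X},\ F(x)\leqslant\prod_{i=1}^n u_i(x_i)\ \forall x\in\mathcal{X}^n\Big\}$$ such that $u_{i,\star}(x_i)=\alpha_{i,\star}+\beta_{i,\star}^\top g_i(x_i)$ for all $i$ and all $x_i\in\mathcal{X}$, then $\rho_n^{U_\star}=\rho_n^{\mathrm{var}}$ for $U_\star(x)=\prod_{i=1}^n u_{i,\star}(x_i)$.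
   Context: Let $\mathcal{X}\subset\mathbb{R}$, let $\mathcal{P}(\mathcal{X})$ be the set of probability distributions on $\mathcal{X}$, and for $i=1,\dots,n$ let $g_i:\mathcal{X}\to\mathbb{R}^m$ be measurable, $\mu_i\in\mathbb{R}^m$, and $\mathcal{P}_{\mu_i}(\mathcal{X})=\{p_i\in\mathcal{P}(\mathcal{X}):\int_{\mathcal{X}}g_i\,dp_i=\mu_i\}$, assumed nonempty. Let $F(x)=\mathbf{1}_{x\in S}$ with $S\subset\mathcal{X}^n$ a compact semi-algebraic set. The generalized problem of moments for independent variables is $$\rho_n=\sup_{p_i\in\mathcal{P}_{\mu_i}(\mathcal{X}),\ i=1,\dots,n}\ \int_{\mathcal{X}^n}F(x)\,dp_1(x_1)\cdots dp_n(x_n).$$ The family of product-functions is $\mathcal{U}=\{U:\mathcal{X}^n\to\mathbb{R}^+ : U(x)=\prod_{i=1}^n u_i(x_i),\ u_i:\mathcal{X}\to\mathbb{R}^+\}$. For $U=\prod_i u_i\in\mathcal{U}$, $$\rho_n^U=\prod_{i=1}^n\ \inf\{\alpha_i+\beta_i^\top\mu_i\ :\ \alpha_i\in\mathbb{R},\beta_i\in\mathbb{R}^m,\ u_i(x_i)\leqslant\alpha_i+\beta_i^\top g_i(x_i)\ \forall x_i\in\mathcal{X}\}.$$ Finally $$\rho_n^{\mathrm{var}}=\inf\Big\{\prod_{i=1}^n(\alpha_i+\beta_i^\top\mu_i)\ :\ \alpha_i\in\mathbb{R},\beta_i\in\mathbb{R}^m,\ \alpha_i+\beta_i^\top g_i(x_i)\geqslant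 0\ \forall i,\forall x_i\in\mathcal{X},\ F(x)\leqslant\prod_{i=1}^n(\alpha_i+\beta_i^\top g_i(x_i))\ \forall x\in\mathcal{X}^n\Big\}.$$ The infimum over an empty set is $+\infty$, and a product with a factor $+\infty$ is $+\infty$. *)

theory Defs
  imports "HOL-Probability.Probability"
begin

definition prob_distributions :: "real set \<Rightarrow> real measure set" where
  "prob_distributions X = {p. prob_space p \<and> sets p = sets (restrict_space borel X)}"

(* Integrability is stated explicitly because the Bochner integral of a
   non-integrable function is 0. *)
definition moment_distributions ::
  "real set \<Rightarrow> (real \<Rightarrow> real^'m) \<Rightarrow> real^'m \<Rightarrow> real measure set" where
  "moment_distributions X g \<mu> =
     {p \<in> prob_distributions X. integrable p g \<and> (\<integral>x. g x \<partial>p) = \<mu>}"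

definition cube :: "real set \<Rightarrow> (real^'n) set" where
  "cube X = {x. \<forall>i. x $ i \<in> X}"

(* The Boolean algebra of sets generated by the strict polynomial inequalities. *)
inductive semialgebraic :: "(real^'n) set \<Rightarrow> bool" where
  pos: "real_polynomial_function P \<Longrightarrow> semialgebraic {x. P x > 0}"
| compl: "semialgebraic A \<Longrightarrow> semialgebraic (- A)"
| union: "semialgebraic A \<Longrightarrow> semialgebraic B \<Longrightarrow> semialgebraic (A \<union> B)"
| inter: "semialgebraic A \<Longrightarrow> semialgebraic B \<Longrightarrow> semialgebraic (A \<inter> B)"

(* The product measure lives on functions 'n => real; vec_lambda transports
   its points to real^'n. *)
definition rho ::
  "real set \<Rightarrow> ('n \<Rightarrow> real \<Rightarrow> real^'m) \<Rightarrow> ('n \<Rightarrow> real^'m) \<Rightarrow> (real^'n \<Rightarrow> real) \<Rightarrow> ereal" where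
  "rho X g \<mu> F =
     (SUP p \<in> {p. \<forall>i. p i \<in> moment_distributions X (g i) (\<mu> i)}.
        ereal (\<integral>w. F (vec_lambda w) \<partial>(Pi\<^sub>M UNIV p)))"

definition is_factorization ::
  "real set \<Rightarrow> (real^'n \<Rightarrow> real) \<Rightarrow> ('n \<Rightarrow> real \<Rightarrow> real) \<Rightarrow> bool" where
  "is_factorization X U u \<longleftrightarrow>
     (\<forall>i. \<forall>t\<in>X. 0 \<le> u i t) \<and> (\<forall>x\<in>cube X. U x = (\<Prod>i\<in>UNIV. u i (x $ i)))"

definition product_functions :: "real set \<Rightarrow> (real^'n \<Rightarrow> real) set" where
  "product_functions X = {U. \<exists>u. is_factorization X U u}"

definition factor_bound ::
  "real set \<Rightarrow> (real \<Rightarrow> real^'m) \<Rightarrow> real^'m \<Rightarrow> (real \<Rightarrow> real) \<Rightarrow> ereal" where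
  "factor_bound X g \<mu> v =
     (INF (\<alpha>, \<beta>) \<in> {(\<alpha>, \<beta>). \<forall>t\<in>X. v t \<le> \<alpha> + \<beta> \<bullet> g t}. ereal (\<alpha> + \<beta> \<bullet> \<mu>))"

(* In ereal, 0 * \<infinity> = 0; here a product with an infinite factor is infinite.
   The argument is the family of factors u rather than the function U, since for
   U = 0 the value can depend on the chosen factors. *)
definition rho_prod ::
  "real set \<Rightarrow> ('n \<Rightarrow> real \<Rightarrow> real^'m) \<Rightarrow> ('n \<Rightarrow> real^'m) \<Rightarrow> ('n \<Rightarrow> real \<Rightarrow> real) \<Rightarrow> ereal" where
  "rho_prod X g \<mu> u =
     (if \<exists>i. factor_bound X (g i) (\<mu> i) (u i) = \<infinity> then \<infinity>
      else (\<Prod>i\<in>UNIV. factor_bound X (g i) (\<mu> i) (u i)))"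

definition dual_value ::
  "('n \<Rightarrow> real^'m) \<Rightarrow> ('n \<Rightarrow> real) \<Rightarrow> ('n \<Rightarrow> real^'m) \<Rightarrow> real" where
  "dual_value \<mu> \<alpha> \<beta> = (\<Prod>i\<in>UNIV. \<alpha> i + \<beta> i \<bullet> \<mu> i)"

definition var_feasible ::
  "real set \<Rightarrow> ('n \<Rightarrow> real \<Rightarrow> real^'m) \<Rightarrow> (real^'n \<Rightarrow> real) \<Rightarrow>
     ('n \<Rightarrow> real) \<Rightarrow> ('n \<Rightarrow> real^'m) \<Rightarrow> bool" where
  "var_feasible X g F \<alpha> \<beta> \<longleftrightarrow>
     (\<forall>i. \<forall>t\<in>X. \<alpha> i + \<beta> i \<bullet> g i t \<ge> 0) \<and>
     (\<forall>x\<in>cube X. F x \<le> (\<Prod>i\<in>UNIV. \<alpha> i + \<beta> i \<bullet> g i (x $ i)))"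

definition rho_var ::
  "real set \<Rightarrow> ('n \<Rightarrow> real \<Rightarrow> real^'m) \<Rightarrow> ('n \<Rightarrow> real^'m) \<Rightarrow> (real^'n \<Rightarrow> real) \<Rightarrow> ereal" where
  "rho_var X g \<mu> F =
     (INF (\<alpha>, \<beta>) \<in> {(\<alpha>, \<beta>). var_feasible X g F \<alpha> \<beta>}. ereal (dual_value \<mu> \<alpha> \<beta>))"

definition joint_feasible ::
  "real set \<Rightarrow> ('n \<Rightarrow> real \<Rightarrow> real^'m) \<Rightarrow> (real^'n \<Rightarrow> real) \<Rightarrow>
     ('n \<Rightarrow> real \<Rightarrow> real) \<Rightarrow> ('n \<Rightarrow> real) \<Rightarrow> ('n \<Rightarrow> real^'m) \<Rightarrow> bool" where
  "joint_feasible X g F u \<alpha> \<beta> \<longleftrightarrow>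
     (\<forall>i. \<forall>t\<in>X. 0 \<le> u i t) \<and>
     (\<forall>i. \<forall>t\<in>X. u i t \<le> \<alpha> i + \<beta> i \<bullet> g i t) \<and>
     (\<forall>x\<in>cube X. F x \<le> (\<Prod>i\<in>UNIV. u i (x $ i)))"

definition joint_optimal ::
  "real set \<Rightarrow> ('n \<Rightarrow> real \<Rightarrow> real^'m) \<Rightarrow> ('n \<Rightarrow> real^'m) \<Rightarrow> (real^'n \<Rightarrow> real) \<Rightarrow>
     ('n \<Rightarrow> real \<Rightarrow> real) \<Rightarrow> ('n \<Rightarrow> real) \<Rightarrow> ('n \<Rightarrow> real^'m) \<Rightarrow> bool" where
  "joint_optimal X g \<mu> F u \<alpha> \<beta> \<longleftrightarrow>
     is_arg_min (\<lambda>(u, \<alpha>, \<beta>). dual_value \<mu> \<alpha> \<beta>)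
       (\<lambda>(u, \<alpha>, \<beta>). joint_feasible X g F u \<alpha> \<beta>) (u, \<alpha>, \<beta>)"

end

theory Submission
  imports Defs
begin

text \<open>Each \<open>\<alpha>\<^sub>i + \<beta>\<^sub>i\<^sup>T g\<^sub>i\<close> integrates to
  \<open>\<alpha>\<^sub>i + \<beta>\<^sub>i\<^sup>T \<mu>\<^sub>i\<close> under every admissible \<open>p\<^sub>i\<close>, so by Fubini
  integrating \<open>F \<le> \<Prod>\<^sub>i (\<alpha>\<^sub>i + \<beta>\<^sub>i\<^sup>T g\<^sub>i)\<close> gives the first inequality.
  Any family of points feasible for the separate factor problems of \<open>u\<close> is feasible for
  the variational problem, and since all factor values are nonnegative the product of their
  infima is a limit of products of feasible values. At an optimal \<open>u\<^sub>\<star>\<close> that is itself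
  affine in \<open>g\<close>, the optimal value is sandwiched between the two bounds.\<close>

lemma affine_moment:
  assumes "p \<in> moment_distributions X g \<mu>"
  shows "integrable p (\<lambda>t. a + b \<bullet> g t)"
    and "(\<integral>t. a + b \<bullet> g t \<partial>p) = a + b \<bullet> \<mu>"
proof -
  interpret prob_space p
    using assms by (simp add: moment_distributions_def prob_distributions_def)
  have g: "integrable p g" "(\<integral>t. g t \<partial>p) = \<mu>"
    using assms by (auto simp: moment_distributions_def)
  show "integrable p (\<lambda>t. a + b \<bullet> g t)"
    using g by simp
  show "(\<integral>t. a + b \<bullet> g t \<partial>p) = a + b \<bullet> \<mu>"
    using g by (simp add: prob_space)
qed

text \<open>Membership fixes the sigma-algebra of \<open>p\<close>, which determines its carrier.
  Bounds assumed on \<open>X\<close> thus hold on all of \<open>space p\<close>.\<close>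

lemma space_moment_distribution:
  assumes "p \<in> moment_distributions X g \<mu>"
  shows "space p = X"
proof -
  have "sets p = sets (restrict_space borel X)"
    using assms by (simp add: moment_distributions_def prob_distributions_def)
  then have "space p = space (restrict_space borel X)"
    by (rule sets_eq_imp_space_eq)
  then show ?thesis
    by (simp add: space_restrict_space)
qed

text \<open>Any admissible \<open>p\<close> realises the value as the integral of a function that is
  nonnegative on \<open>X\<close>; this is where nonemptiness of the moment class enters.\<close>

lemma affine_moment_nonneg:
  assumes "moment_distributions X g \<mu> \<noteq> {}" and "\<And>t. t \<in> X \<Longrightarrow> 0 \<le> a + b \<bullet> g t"
  shows "0 \<le> a + b \<bullet> \<mu>"
proof -
  obtain p where p: "p \<in> moment_distributions X g \<mu>"
    using assms(1) by blast
  have "0 \<le> (\<integral>t. a + b \<bullet> g t \<partial>p)"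
    using assms(2) by (intro integral_nonneg_AE AE_I2) (simp add: space_moment_distribution[OF p])
  then show ?thesis
    by (simp add: affine_moment(2)[OF p])
qed

lemma factor_bound_nonneg:
  assumes "moment_distributions X g \<mu> \<noteq> {}" and "\<And>t. t \<in> X \<Longrightarrow> 0 \<le> v t"
  shows "0 \<le> factor_bound X g \<mu> v"
  unfolding factor_bound_def
  by (rule INF_greatest) (force intro!: affine_moment_nonneg[OF assms(1)] intro: order_trans[OF assms(2)])

lemma factor_bound_le:
  assumes "\<And>t. t \<in> X \<Longrightarrow> v t \<le> a + b \<bullet> g t"
  shows "factor_bound X g \<mu> v \<le> ereal (a + b \<bullet> \<mu>)"
  unfolding factor_bound_def using assms by (intro INF_lower2[of "(a, b)"]) auto

lemma rho_var_le:
  assumes "var_feasible X g F a b"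
  shows "rho_var X g \<mu> F \<le> ereal (dual_value \<mu> a b)"
  unfolding rho_var_def using assms by (intro INF_lower2[of "(a, b)"]) auto

lemma rho_le_rho_var: "rho X g \<mu> F \<le> rho_var X g \<mu> F"
  unfolding rho_def rho_var_def
proof (intro SUP_least INF_greatest, clarsimp)
  fix p :: "'a \<Rightarrow> real measure" and a :: "'a \<Rightarrow> real" and b
  assume p: "\<forall>i. p i \<in> moment_distributions X (g i) (\<mu> i)"
    and feas: "var_feasible X g F a b"
  have ps: "prob_space (p i)" for i
    using p by (simp add: moment_distributions_def prob_distributions_def)
  interpret product_sigma_finite p
    using ps by (simp add: product_sigma_finite_def prob_space_imp_sigma_finite)
  let ?h = "\<lambda>i t. a i + b i \<bullet> g i t"
  have int: "integrable (Pi\<^sub>M UNIV p) (\<lambda>w. \<Prod>i\<in>UNIV. ?h i (w i))"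
    by (intro product_integrable_prod) (simp_all add: affine_moment(1)[OF p[rule_format]])
  have "(\<integral>w. F (vec_lambda w) \<partial>(Pi\<^sub>M UNIV p)) \<le> (\<integral>w. (\<Prod>i\<in>UNIV. ?h i (w i)) \<partial>(Pi\<^sub>M UNIV p))"
  \<comment> \<open>This rule asks for integrability and nonnegativity of the larger function alone:
    were the smaller one not integrable, its Bochner integral would be 0.\<close>
  proof (rule integral_mono'[OF int])
    fix w assume "w \<in> space (Pi\<^sub>M UNIV p)"
    then have w: "w i \<in> X" for i
      by (auto simp: space_PiM PiE_def Pi_def space_moment_distribution[OF p[rule_format]])
    then have "vec_lambda w \<in> cube X"
      by (simp add: cube_def)
    then show "F (vec_lambda w) \<le> (\<Prod>i\<in>UNIV. ?h i (w i))"
      using feas unfolding var_feasible_def by fastforce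
    show "0 \<le> (\<Prod>i\<in>UNIV. ?h i (w i))"
      using feas w by (auto simp: var_feasible_def intro: prod_nonneg)
  qed
  also have "\<dots> = (\<Prod>i\<in>UNIV. \<integral>t. ?h i t \<partial>p i)"
    by (intro product_integral_prod) (simp_all add: affine_moment(1)[OF p[rule_format]])
  also have "\<dots> = dual_value \<mu> a b"
    by (simp add: dual_value_def affine_moment(2)[OF p[rule_format]])
  finally show "(\<integral>w. F (vec_lambda w) \<partial>(Pi\<^sub>M UNIV p)) \<le> dual_value \<mu> a b" .
qed

text \<open>Moves the product of factor bounds from \<open>ereal\<close> to \<open>real\<close>,
  where monotonicity and continuity of finite products apply. Nonnegativity rules out the value of
  minus infinity.\<close>

lemma prod_factor_bound_real:
  assumes "\<And>i. moment_distributions X (g i) (\<mu> i) \<noteq> {}"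
    and "\<And>i t. t \<in> X \<Longrightarrow> 0 \<le> u i t"
    and "\<And>i. factor_bound X (g i) (\<mu> i) (u i) \<noteq> \<infinity>"
  obtains c where "\<And>i. factor_bound X (g i) (\<mu> i) (u i) = ereal (c i)" and "\<And>i. 0 \<le> c i"
    and "rho_prod X g \<mu> u = ereal (\<Prod>i\<in>UNIV. c i)"
proof -
  define c where "c i = real_of_ereal (factor_bound X (g i) (\<mu> i) (u i))" for i
  have nonneg: "0 \<le> factor_bound X (g i) (\<mu> i) (u i)" for i
    using assms(1,2) by (rule factor_bound_nonneg)
  have c: "factor_bound X (g i) (\<mu> i) (u i) = ereal (c i)" for i
    using nonneg[of i] assms(3)[of i] unfolding c_def
    by (cases "factor_bound X (g i) (\<mu> i) (u i)") auto
  moreover have "0 \<le> c i" for i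
    using nonneg[of i] c[of i] by simp
  moreover have "rho_prod X g \<mu> u = ereal (\<Prod>i\<in>UNIV. c i)"
    unfolding rho_prod_def c by (simp add: prod_ereal)
  ultimately show ?thesis
    using that by blast
qed

text \<open>The factor infima need not be attained, so each is approximated within a common slack
  \<open>e\<close>, and \<open>e\<close> tends to 0 at the end.\<close>

lemma rho_var_le_rho_prod:
  assumes "\<And>i. moment_distributions X (g i) (\<mu> i) \<noteq> {}"
    and u: "\<And>i t. t \<in> X \<Longrightarrow> 0 \<le> u i t"
    and F: "\<And>x. x \<in> cube X \<Longrightarrow> F x \<le> (\<Prod>i\<in>UNIV. u i (x $ i))"
  shows "rho_var X g \<mu> F \<le> rho_prod X g \<mu> u"
proof (cases "\<exists>i. factor_bound X (g i) (\<mu> i) (u i) = \<infinity>")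
  case True
  then show ?thesis
    by (simp add: rho_prod_def)
next
  case False
  obtain c where c: "\<And>i. factor_bound X (g i) (\<mu> i) (u i) = ereal (c i)"
    and c_nonneg: "\<And>i. 0 \<le> c i" and prod_c: "rho_prod X g \<mu> u = ereal (\<Prod>i\<in>UNIV. c i)"
    by (rule prod_factor_bound_real[of X g \<mu> u, OF assms(1) u]) (use False in auto)
  have upper: "rho_var X g \<mu> F \<le> ereal (\<Prod>i\<in>UNIV. c i + e)" if "0 < e" for e
  proof -
    \<comment> \<open>Since \<open>c i\<close> is finite, \<open>c i + e\<close> lies strictly above
      the infimum, so some feasible pair has a value below it.\<close>
    have "\<exists>a b. (\<forall>t\<in>X. u i t \<le> a + b \<bullet> g i t) \<and> a + b \<bullet> \<mu> i < c i + e" for i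
    proof -
      have "factor_bound X (g i) (\<mu> i) (u i) < ereal (c i + e)"
        using c \<open>0 < e\<close> by simp
      then show ?thesis
        unfolding factor_bound_def by (auto simp: INF_less_iff)
    qed
    then obtain a b where ab: "\<And>i t. t \<in> X \<Longrightarrow> u i t \<le> a i + b i \<bullet> g i t"
      and less: "\<And>i. a i + b i \<bullet> \<mu> i < c i + e"
      by metis
    have nonneg: "0 \<le> a i + b i \<bullet> g i t" if "t \<in> X" for i t
      using ab[OF that] u[OF that] by (rule order_trans[rotated])
    have "F x \<le> (\<Prod>i\<in>UNIV. a i + b i \<bullet> g i (x $ i))" if "x \<in> cube X" for x
    proof -
      have "(\<Prod>i\<in>UNIV. u i (x $ i)) \<le> (\<Prod>i\<in>UNIV. a i + b i \<bullet> g i (x $ i))"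
        using that u ab by (intro prod_mono) (auto simp: cube_def)
      with F[OF that] show ?thesis
        by simp
    qed
    then have "var_feasible X g F a b"
      using nonneg by (simp add: var_feasible_def)
    then have "rho_var X g \<mu> F \<le> ereal (dual_value \<mu> a b)"
      by (rule rho_var_le)
    \<comment> \<open>Comparing products factor by factor needs nonnegative smaller factors; the
      chosen affine functions dominate \<open>u i\<close>, hence are nonnegative on
      \<open>X\<close>, and so are their moments.\<close>
    also have "dual_value \<mu> a b \<le> (\<Prod>i\<in>UNIV. c i + e)"
      unfolding dual_value_def
      using less by (intro prod_mono) (auto intro: affine_moment_nonneg[OF assms(1) nonneg] less_imp_le)
    finally show ?thesis
      by simp
  qed
  \<comment> \<open>A finite product is continuous in its factors, so the bound survives the limit
    from the right.\<close>
  have "((\<lambda>e. \<Prod>i\<in>UNIV. c i + e) \<longlongrightarrow> (\<Prod>i\<in>UNIV. c i + 0)) (at_right 0)"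
    by (intro tendsto_intros)
  then have "((\<lambda>e. ereal (\<Prod>i\<in>UNIV. c i + e)) \<longlongrightarrow> rho_prod X g \<mu> u) (at_right 0)"
    by (simp add: prod_c)
  moreover have "\<forall>\<^sub>F e in at_right 0. rho_var X g \<mu> F \<le> ereal (\<Prod>i\<in>UNIV. c i + e)"
    using upper by (auto simp: eventually_at_filter)
  ultimately show ?thesis
    by (rule tendsto_lowerbound) simp
qed

text \<open>Each pair \<open>(a i, b i)\<close> competes in the infimum for factor \<open>i\<close>.
  Its value makes that infimum finite, and the nonnegative factor bounds can then be
  multiplied.\<close>

lemma rho_prod_le_dual_value:
  assumes "\<And>i. moment_distributions X (g i) (\<mu> i) \<noteq> {}"
    and u: "\<And>i t. t \<in> X \<Longrightarrow> 0 \<le> u i t"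
    and ab: "\<And>i t. t \<in> X \<Longrightarrow> u i t \<le> a i + b i \<bullet> g i t"
  shows "rho_prod X g \<mu> u \<le> ereal (dual_value \<mu> a b)"
proof -
  have bound: "factor_bound X (g i) (\<mu> i) (u i) \<le> ereal (a i + b i \<bullet> \<mu> i)" for i
    using ab by (rule factor_bound_le)
  have finite_bound: "factor_bound X (g i) (\<mu> i) (u i) \<noteq> \<infinity>" for i
    using bound[of i] by auto
  obtain c where c: "\<And>i. factor_bound X (g i) (\<mu> i) (u i) = ereal (c i)"
    and c_nonneg: "\<And>i. 0 \<le> c i" and prod_c: "rho_prod X g \<mu> u = ereal (\<Prod>i\<in>UNIV. c i)"
    by (rule prod_factor_bound_real[of X g \<mu> u, OF assms(1) u]) (use finite_bound in auto)
  have "(\<Prod>i\<in>UNIV. c i) \<le> dual_value \<mu> a b"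
    unfolding dual_value_def using bound c c_nonneg by (intro prod_mono) auto
  then show ?thesis
    by (simp add: prod_c)
qed

text \<open>Both problems have the same objective. Where the factors equal their affine majorants,
  the joint constraints become the variational ones, so the joint optimum is a variational
  competitor.\<close>

lemma rho_var_eq_joint_optimal:
  assumes "joint_optimal X g \<mu> F u a b"
    and eq: "\<And>i t. t \<in> X \<Longrightarrow> u i t = a i + b i \<bullet> g i t"
  shows "rho_var X g \<mu> F = ereal (dual_value \<mu> a b)"
proof (rule antisym)
  have feas: "joint_feasible X g F u a b"
    and opt: "\<And>u' a' b'. joint_feasible X g F u' a' b' \<Longrightarrow> dual_value \<mu> a b \<le> dual_value \<mu> a' b'"
    using assms(1) unfolding joint_optimal_def is_arg_min_linorder by auto
  have "var_feasible X g F a b"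
    using feas eq by (simp add: joint_feasible_def var_feasible_def cube_def)
  then show "rho_var X g \<mu> F \<le> ereal (dual_value \<mu> a b)"
    by (rule rho_var_le)
  \<comment> \<open>Conversely, the affine functions of a variational competitor serve as their own
    factors \<open>u'\<close>, so joint optimality applies to it.\<close>
  have "dual_value \<mu> a b \<le> dual_value \<mu> a' b'" if "var_feasible X g F a' b'" for a' b'
    using that by (intro opt[of "\<lambda>i t. a' i + b' i \<bullet> g i t"])
      (simp add: joint_feasible_def var_feasible_def)
  then show "ereal (dual_value \<mu> a b) \<le> rho_var X g \<mu> F"
    unfolding rho_var_def by (intro INF_greatest) auto
qed

theorem proposition2:
  fixes X :: "real set"
    and g :: "'n::finite \<Rightarrow> real \<Rightarrow> real^'m"
    and \<mu> :: "'n \<Rightarrow> real^'m"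
    and S :: "(real^'n) set"
    and F :: "real^'n \<Rightarrow> real"
  assumes "\<And>i. g i \<in> borel_measurable (restrict_space borel X)"
    and "\<And>i. moment_distributions X (g i) (\<mu> i) \<noteq> {}"
    and "S \<subseteq> cube X" and "compact S" and "semialgebraic S"
    and "F = indicat_real S"
  shows "(\<forall>U \<in> product_functions X. (\<forall>x \<in> cube X. F x \<le> U x) \<longrightarrow>
            (\<forall>u. is_factorization X U u \<longrightarrow>
               rho X g \<mu> F \<le> rho_var X g \<mu> F \<and> rho_var X g \<mu> F \<le> rho_prod X g \<mu> u)) \<and>
         (\<forall>u \<alpha> \<beta>. joint_optimal X g \<mu> F u \<alpha> \<beta> \<longrightarrow>
            (\<forall>i. \<forall>t \<in> X. u i t = \<alpha> i + \<beta> i \<bullet> g i t) \<longrightarrow>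
            rho_prod X g \<mu> u = rho_var X g \<mu> F)"
proof (intro conjI ballI allI impI)
  fix U u
  assume "\<forall>x\<in>cube X. F x \<le> U x" and "is_factorization X U u"
  then show "rho_var X g \<mu> F \<le> rho_prod X g \<mu> u"
    by (intro rho_var_le_rho_prod assms(2)) (auto simp: is_factorization_def)
next
  fix u \<alpha> \<beta>
  assume opt: "joint_optimal X g \<mu> F u \<alpha> \<beta>"
    and eq: "\<forall>i. \<forall>t\<in>X. u i t = \<alpha> i + \<beta> i \<bullet> g i t"
  have feas: "joint_feasible X g F u \<alpha> \<beta>"
    using opt by (simp add: joint_optimal_def is_arg_min_def)
  show "rho_prod X g \<mu> u = rho_var X g \<mu> F"
  proof (rule antisym)
    have "rho_prod X g \<mu> u \<le> ereal (dual_value \<mu> \<alpha> \<beta>)"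
      using feas by (intro rho_prod_le_dual_value assms(2)) (auto simp: joint_feasible_def)
    also have "\<dots> = rho_var X g \<mu> F"
      using rho_var_eq_joint_optimal[OF opt] eq by simp
    finally show "rho_prod X g \<mu> u \<le> rho_var X g \<mu> F" .
    show "rho_var X g \<mu> F \<le> rho_prod X g \<mu> u"
      using feas by (intro rho_var_le_rho_prod assms(2)) (auto simp: joint_feasible_def)
  qed
\<comment> \<open>The goal still open is the bound on the moment problem itself.\<close>
qed (rule rho_le_rho_var)

end
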